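(* Consider the single decision maker setting described in the context. Fix a round $t$ and suppose: (H1) $\mathcal{E}_t=\boldsymbol{\mathcal{E}}$ for a fixed matrix $\boldsymbol{\mathcal{E}}\in\mathbb{R}^{m\times d}$ common to all agents; (H2) $\gamma_t=\gamma$ for a constant $\gamma$ common to all agents, and $\gamma>0$; (S1) there are $\boldsymbol{\alpha}\in\mathbb{R}^m$ and $\beta\in\mathbb{R}$ with $\mathrm{cBP}(\boldsymbol{\theta}_t)=\boldsymbol{\alpha}^\top\boldsymbol{\theta}_t+\beta$ for all admissible $\boldsymbol{\theta}_t$; (S2) the admissible parameters are those $\boldsymbol{\theta}_t\in\mathbb{R}^m$ with $\|\boldsymbol{\theta}_t\|_2\le 1$. If $\boldsymbol{\alpha}=(k-\gamma)\boldsymbol{\mathcal{E}}\boldsymbol{\mathcal{E}}^\top\boldsymbol{\theta}^*$ for some $k>0$, then the maximiser of $\mathcal{Q}(\boldsymbol{\theta}_t)$ over admissible $\boldsymbol{\theta}_t$ is also the maximiser of $\mathrm{cPI}(\boldsymbol{\theta}_t)$ over admissible $\boldsymbol{\theta}_t$.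
   Context: Single decision maker (DM) setting. In round $t$ the DM publishes a parameter vector $\boldsymbol{\theta}_t\in\mathbb{R}^m$ and a selection rule $\boldsymbol{\delta}_{\boldsymbol{\theta}_t}:\mathbb{R}^m\to[0,1]$. An agent arrives with random baseline $B_t\in\mathbb{R}^m$, effort conversion matrix $\mathcal{E}_t\in\mathbb{R}^{m\times d}$ and real-valued noise $O_t$ (possibly correlated with $B_t$). If the agent takes action $\mathbf{a}\in\mathbb{R}^d$, its covariates are $X_t=B_t+\mathcal{E}_t\mathbf{a}$ and its predicted outcome is $\hat y_t=X_t^\top\boldsymbol{\theta}_t$. The agent chooses the action maximising $\gamma_t\hat y_t-\frac12\|\mathbf{a}\|_2^2$ (with $\gamma_t\ge0$), i.e. $\mathbf{a}_t=\gamma_t\mathcal{E}_t^\top\boldsymbol{\theta}_t$, so $X_t=B_t+\gamma_t\mathcal{E}_t\mathcal{E}_t^\top\boldsymbol{\theta}_t$. The selection status is $W_t\in\{0,1\}$ with $W_t\sim\mathrm{Bernoulli}(\boldsymbol{\delta}_{\boldsymbol{\theta}_t}(X_t))$ given $X_t$; selected agents comply. The outcome is $Y_t=X_t^\top\boldsymbol{\theta}^*+O_t$, where $\boldsymbol{\theta}^*\in\mathbb{R}^m$ is a fixed true causal parameter. Conditional expectations given $W_t=1$ are assumed well defined. The notation "$;\boldsymbol{\theta}_t$" indicates that the distribution is the one induced by deploying $\boldsymbol{\theta}_t$. The objective decomposes as $$\mathcal{Q}(\boldsymbol{\theta}_t)=\mathbb{E}[Y_t\mid W_t=1;\boldsymbol{\theta}_t]=\mathrm{cBP}(\boldsymbol{\theta}_t)+\mathrm{cPI}(\boldsymbol{\theta}_t),$$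 $$\mathrm{cBP}(\boldsymbol{\theta}_t)=\mathbb{E}[B_t^\top\boldsymbol{\theta}^*+O_t\mid W_t=1;\boldsymbol{\theta}_t],\qquad \mathrm{cPI}(\boldsymbol{\theta}_t)=\mathbb{E}[(\mathcal{E}_t\mathbf{a}_t)^\top\boldsymbol{\theta}^*\mid W_t=1;\boldsymbol{\theta}_t].$$ *)

theory Defs
  imports "HOL-Probability.Probability"
begin

text \<open>
  One round of the single decision maker setting; the round index is dropped.
  All random quantities live on one probability space \<open>M\<close>. The agent's type
  \<open>(B, Ecal, gam, Oc)\<close> does not depend on the deployed parameter \<open>\<theta>\<close>, whereas the action,
  the covariates, the selection status and the outcome do; ``\<open>; \<theta>\<close>'' in the informal
  notation is the explicit argument \<open>\<theta>\<close> here.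
\<close>

subsection \<open>The agent's response\<close>

definition covariates :: "real^'m \<Rightarrow> real^'d^'m \<Rightarrow> real^'d \<Rightarrow> real^'m" where
  "covariates b E a = b + E *v a"

definition agent_payoff :: "real \<Rightarrow> real^'m \<Rightarrow> real^'d^'m \<Rightarrow> real^'m \<Rightarrow> real^'d \<Rightarrow> real" where
  "agent_payoff g b E \<theta> a = g * (covariates b E a \<bullet> \<theta>) - 1/2 * (norm a)\<^sup>2"

definition best_action :: "real \<Rightarrow> real^'m \<Rightarrow> real^'d^'m \<Rightarrow> real^'m \<Rightarrow> real^'d" where
  "best_action g b E \<theta> = (ARG_MAX (agent_payoff g b E \<theta>) a. True)"

lemma agent_payoff_complete_square:
  "agent_payoff g b E \<theta> a =
     g * (b \<bullet> \<theta>) + 1/2 * (norm (g *\<^sub>R (transpose E *v \<theta>)))\<^sup>2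
       - 1/2 * (norm (a - g *\<^sub>R (transpose E *v \<theta>)))\<^sup>2"
proof -
  have "(E *v a) \<bullet> \<theta> = a \<bullet> (transpose E *v \<theta>)"
    by (metis dot_lmul_matrix inner_commute transpose_matrix_vector)
  then show ?thesis
    unfolding agent_payoff_def covariates_def power2_norm_eq_inner
    by (simp add: inner_add_left inner_diff_left inner_diff_right inner_commute algebra_simps)
qed

lemma is_arg_max_agent_payoff_iff:
  "is_arg_max (agent_payoff g b E \<theta>) (\<lambda>_. True) a \<longleftrightarrow> a = g *\<^sub>R (transpose E *v \<theta>)"
proof -
  let ?c = "g *\<^sub>R (transpose E *v \<theta>)"
  have "(agent_payoff g b E \<theta> a < agent_payoff g b E \<theta> y) \<longleftrightarrow>
      (norm (y - ?c))\<^sup>2 < (norm (a - ?c))\<^sup>2" for y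
    by (simp add: agent_payoff_complete_square)
  then have "is_arg_max (agent_payoff g b E \<theta>) (\<lambda>_. True) a \<longleftrightarrow>
      (\<forall>y. (norm (a - ?c))\<^sup>2 \<le> (norm (y - ?c))\<^sup>2)"
    by (auto simp: is_arg_max_def not_less)
  also have "\<dots> \<longleftrightarrow> a = ?c"
  proof
    assume "\<forall>y. (norm (a - ?c))\<^sup>2 \<le> (norm (y - ?c))\<^sup>2"
    from this[rule_format, of ?c] show "a = ?c" by simp
  qed simp
  finally show ?thesis .
qed

lemma best_action_eq: "best_action g b E \<theta> = g *\<^sub>R (transpose E *v \<theta>)"
  unfolding best_action_def arg_max_def is_arg_max_agent_payoff_iff by simp

subsection \<open>Selection, outcomes and objectives\<close>

locale selection_primitives =
  fixes M :: "'w measure"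
    and B :: "'w \<Rightarrow> real^'m"
    and Ecal :: "'w \<Rightarrow> real^'d^'m"
    and gam :: "'w \<Rightarrow> real"
    and Oc :: "'w \<Rightarrow> real"
    and \<theta>star :: "real^'m"
    and \<delta> :: "real^'m \<Rightarrow> real^'m \<Rightarrow> real"
    and W :: "real^'m \<Rightarrow> 'w \<Rightarrow> bool"
    and Adm :: "(real^'m) set"
begin

definition act :: "real^'m \<Rightarrow> 'w \<Rightarrow> real^'d" where
  "act \<theta> \<omega> = best_action (gam \<omega>) (B \<omega>) (Ecal \<omega>) \<theta>"

definition X :: "real^'m \<Rightarrow> 'w \<Rightarrow> real^'m" where
  "X \<theta> \<omega> = covariates (B \<omega>) (Ecal \<omega>) (act \<theta> \<omega>)"

definition Y :: "real^'m \<Rightarrow> 'w \<Rightarrow> real" where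
  "Y \<theta> \<omega> = X \<theta> \<omega> \<bullet> \<theta>star + Oc \<omega>"

definition selected :: "real^'m \<Rightarrow> 'w set" where
  "selected \<theta> = {\<omega> \<in> space M. W \<theta> \<omega>}"

text \<open>The conditional distribution \<open>P(\<cdot> | W = 1; \<theta>)\<close>.\<close>

definition sel_law :: "real^'m \<Rightarrow> 'w measure" where
  "sel_law \<theta> = uniform_measure M (selected \<theta>)"

definition Q :: "real^'m \<Rightarrow> real" where
  "Q \<theta> = (LINT \<omega>|sel_law \<theta>. Y \<theta> \<omega>)"

definition cBP :: "real^'m \<Rightarrow> real" where
  "cBP \<theta> = (LINT \<omega>|sel_law \<theta>. B \<omega> \<bullet> \<theta>star + Oc \<omega>)"

definition cPI :: "real^'m \<Rightarrow> real" where
  "cPI \<theta> = (LINT \<omega>|sel_law \<theta>. (Ecal \<omega> *v act \<theta> \<omega>) \<bullet> \<theta>star)"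

end

text \<open>
  \<open>Adm\<close> is the set of admissible parameters. \<open>W_bernoulli\<close> states that, conditionally on
  the covariates, the selection status is Bernoulli with parameter \<open>\<delta> \<theta> (X \<theta>)\<close>; the
  sigma-algebra generated by \<open>X \<theta>\<close> is written as a \<open>vimage_algebra\<close>. The last three
  assumptions say that the conditional expectations given selection are well defined.
\<close>

locale selection_setting = selection_primitives + prob_space M +
  assumes B_rv: "random_variable borel B"
    and Ecal_rv: "random_variable borel Ecal"
    and gam_rv: "random_variable borel gam"
    and Oc_rv: "random_variable borel Oc"
    and gam_nonneg: "AE \<omega> in M. 0 \<le> gam \<omega>"
    and \<delta>_measurable: "\<And>\<theta>. \<theta> \<in> Adm \<Longrightarrow> \<delta> \<theta> \<in> borel_measurable borel"
    and \<delta>_range: "\<And>\<theta> x. \<theta> \<in> Adm \<Longrightarrow> \<delta> \<theta> x \<in> {0..1}"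
    and W_rv: "\<And>\<theta>. \<theta> \<in> Adm \<Longrightarrow> random_variable (count_space UNIV) (W \<theta>)"
    and W_bernoulli: "\<And>\<theta>. \<theta> \<in> Adm \<Longrightarrow>
          AE \<omega> in M. real_cond_exp M (vimage_algebra (space M) (X \<theta>) borel)
                        (indicator (selected \<theta>)) \<omega> = \<delta> \<theta> (X \<theta> \<omega>)"
    and selected_pos: "\<And>\<theta>. \<theta> \<in> Adm \<Longrightarrow> 0 < prob (selected \<theta>)"
    and cBP_integrable: "\<And>\<theta>. \<theta> \<in> Adm \<Longrightarrow>
          integrable (sel_law \<theta>) (\<lambda>\<omega>. B \<omega> \<bullet> \<theta>star + Oc \<omega>)"
    and cPI_integrable: "\<And>\<theta>. \<theta> \<in> Adm \<Longrightarrow>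
          integrable (sel_law \<theta>) (\<lambda>\<omega>. (Ecal \<omega> *v act \<theta> \<omega>) \<bullet> \<theta>star)"

end

theory Submission
  imports Defs
begin

text \<open>
  On the admissible set both objectives are positive affine functions of the same linear form:
  with \<open>v = (E ** transpose E) *v \<theta>star\<close>, the best response gives \<open>cPI \<theta> = \<gamma> * (v \<bullet> \<theta>)\<close>,
  and adding \<open>cBP \<theta> = (k - \<gamma>) * (v \<bullet> \<theta>) + \<beta>\<close> gives \<open>Q \<theta> = k * (v \<bullet> \<theta>) + \<beta>\<close>. As \<open>\<gamma>\<close> and \<open>k\<close>
  are positive, both are maximised exactly where \<open>v \<bullet> \<theta>\<close> is.
\<close>

lemma matrix_vector_mult_inner_transpose:
  fixes A :: "real^'n^'m"
  shows "(A *v x) \<bullet> y = x \<bullet> (transpose A *v y)"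
  by (metis dot_lmul_matrix inner_commute transpose_matrix_vector)

text \<open>\<open>E ** transpose E\<close> is self-adjoint, so \<open>x\<close> and
  \<open>y\<close> can trade places; this exposes \<open>cPI\<close> as a linear form in the
  deployed parameter.\<close>

lemma gram_matrix_inner_commute:
  fixes E :: "real^'d^'m"
  shows "(E *v (transpose E *v x)) \<bullet> y = ((E ** transpose E) *v y) \<bullet> x"
  by (metis inner_commute matrix_vector_mul_assoc matrix_vector_mult_inner_transpose)

text \<open>A positive slope preserves strict order, and \<open>is_arg_max\<close> only compares
  points satisfying \<open>P\<close>, so the relation is required only there.\<close>

lemma is_arg_max_pos_affine_iff:
  fixes f g :: "'a \<Rightarrow> real"
  assumes "\<And>x. P x \<Longrightarrow> f x = a * g x + b" "a > 0"
  shows "is_arg_max f P x \<longleftrightarrow> is_arg_max g P x"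
  using assms by (auto simp: is_arg_max_def)

lemma ex_is_arg_max_compact:
  fixes f :: "'a::topological_space \<Rightarrow> real"
  assumes "compact S" "S \<noteq> {}" "continuous_on S f"
  shows "\<exists>x. is_arg_max f (\<lambda>x. x \<in> S) x"
  using continuous_attains_sup[OF assms] by (auto simp: is_arg_max_linorder)

context selection_setting
begin

lemma selected_sets:
  assumes "\<theta> \<in> Adm"
  shows "selected \<theta> \<in> events"
proof -
  have "selected \<theta> = W \<theta> -` {True} \<inter> space M"
    by (auto simp: selected_def)
  then show ?thesis
    using measurable_sets[OF W_rv[OF assms], of "{True}"] by simp
qed

lemma prob_space_sel_law:
  assumes "\<theta> \<in> Adm"
  shows "prob_space (sel_law \<theta>)"
  unfolding sel_law_def using selected_pos[OF assms]
  by (intro prob_space_uniform_measure) (auto simp: emeasure_eq_measure)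

text \<open>Conditioning on an event keeps null sets null. This carries almost sure facts about the
  agent's type over to the law the objectives integrate against.\<close>

lemma AE_sel_law:
  assumes "\<theta> \<in> Adm" "AE \<omega> in M. P \<omega>"
  shows "AE \<omega> in sel_law \<theta>. P \<omega>"
  unfolding sel_law_def using assms(2)
  by (intro AE_uniform_measureI selected_sets assms(1)) auto

lemma Q_eq_cBP_plus_cPI:
  assumes "\<theta> \<in> Adm"
  shows "Q \<theta> = cBP \<theta> + cPI \<theta>"
proof -
  have "Y \<theta> = (\<lambda>\<omega>. (B \<omega> \<bullet> \<theta>star + Oc \<omega>) + (Ecal \<omega> *v act \<theta> \<omega>) \<bullet> \<theta>star)"
    by (simp add: fun_eq_iff Y_def X_def covariates_def inner_add_left)
  then show ?thesis
    unfolding Q_def cBP_def cPI_def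
    using Bochner_Integration.integral_add[OF cBP_integrable cPI_integrable] assms by simp
qed

text \<open>With a common matrix and a common \<open>\<gamma>\<close> the integrand is almost surely
  constant, so its mean under any selection law is that constant.\<close>

lemma cPI_homogeneous:
  assumes "\<theta> \<in> Adm" "AE \<omega> in M. Ecal \<omega> = E" "AE \<omega> in M. gam \<omega> = \<gamma>"
  shows "cPI \<theta> = \<gamma> * (((E ** transpose E) *v \<theta>star) \<bullet> \<theta>)"
proof -
  interpret sel: prob_space "sel_law \<theta>"
    by (rule prob_space_sel_law[OF assms(1)])
  \<comment> \<open>The simp rule \<open>transpose_matrix_vector\<close> would turn
    \<open>transpose E *v \<theta>\<close> into a \<open>v*\<close> product, which
    \<open>gram_matrix_inner_commute\<close> does not match.\<close>
  have "AE \<omega> in M. (Ecal \<omega> *v act \<theta> \<omega>) \<bullet> \<theta>star = \<gamma> * (((E ** transpose E) *v \<theta>star) \<bullet> \<theta>)"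
    using assms(2,3)
    by eventually_elim
       (simp add: act_def best_action_eq matrix_vector_mult_scaleR gram_matrix_inner_commute
          del: transpose_matrix_vector)
  then have "cPI \<theta> = (LINT \<omega>|sel_law \<theta>. \<gamma> * (((E ** transpose E) *v \<theta>star) \<bullet> \<theta>))"
    unfolding cPI_def
    by (intro integral_cong_AE AE_sel_law borel_measurable_integrable[OF cPI_integrable] assms(1))
       auto
  then show ?thesis
    by (simp add: sel.prob_space)
qed

end

theorem corollary3p2:
  fixes M :: "'w measure"
    and B :: "'w \<Rightarrow> real^'m"
    and Ecal :: "'w \<Rightarrow> real^'d^'m"
    and gam Oc :: "'w \<Rightarrow> real"
    and \<theta>star :: "real^'m"
    and \<delta> :: "real^'m \<Rightarrow> real^'m \<Rightarrow> real"
    and W :: "real^'m \<Rightarrow> 'w \<Rightarrow> bool"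
    and Adm :: "(real^'m) set"
    and E :: "real^'d^'m"
    and \<gamma> \<beta> k :: real
    and \<alpha> :: "real^'m"
  defines "Q \<equiv> selection_primitives.Q M B Ecal gam Oc \<theta>star W"
    and "cBP \<equiv> selection_primitives.cBP M B Oc \<theta>star W"
    and "cPI \<equiv> selection_primitives.cPI M B Ecal gam \<theta>star W"
  assumes setting: "selection_setting M B Ecal gam Oc \<theta>star \<delta> W Adm"
    and H1: "AE \<omega> in M. Ecal \<omega> = E"
    and H2: "AE \<omega> in M. gam \<omega> = \<gamma>" "\<gamma> > 0"
    and S1: "\<forall>\<theta>\<in>Adm. cBP \<theta> = \<alpha> \<bullet> \<theta> + \<beta>"
    and S2: "Adm = {\<theta>. norm \<theta> \<le> 1}"
    and k: "k > 0" "\<alpha> = (k - \<gamma>) *\<^sub>R ((E ** transpose E) *v \<theta>star)"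
  shows "(\<exists>\<theta>. is_arg_max Q (\<lambda>\<theta>. \<theta> \<in> Adm) \<theta>) \<and>
         (\<forall>\<theta>. is_arg_max Q (\<lambda>\<theta>. \<theta> \<in> Adm) \<theta> \<longleftrightarrow> is_arg_max cPI (\<lambda>\<theta>. \<theta> \<in> Adm) \<theta>)"
proof -
  interpret S: selection_setting M B Ecal gam Oc \<theta>star \<delta> W Adm
    by (rule setting)
  let ?v = "(E ** transpose E) *v \<theta>star"
  \<comment> \<open>The \<open>+ 0\<close> gives the affine shape that
    \<open>is_arg_max_pos_affine_iff\<close> expects.\<close>
  have cPI: "cPI \<theta> = \<gamma> * (?v \<bullet> \<theta>) + 0" if "\<theta> \<in> Adm" for \<theta>
    unfolding cPI_def using S.cPI_homogeneous[OF that H1 H2(1)] by simp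
  have Q: "Q \<theta> = k * (?v \<bullet> \<theta>) + \<beta>" if "\<theta> \<in> Adm" for \<theta>
  proof -
    have "Q \<theta> = cBP \<theta> + cPI \<theta>"
      unfolding Q_def cBP_def cPI_def by (rule S.Q_eq_cBP_plus_cPI[OF that])
    then show ?thesis
      using S1 that cPI[OF that] k(2) by (simp add: algebra_simps)
  qed
  have Q_iff: "is_arg_max Q (\<lambda>\<theta>. \<theta> \<in> Adm) \<theta> \<longleftrightarrow> is_arg_max (\<lambda>\<theta>. ?v \<bullet> \<theta>) (\<lambda>\<theta>. \<theta> \<in> Adm) \<theta>" for \<theta>
    by (rule is_arg_max_pos_affine_iff[OF Q k(1)])
  have cPI_iff: "is_arg_max cPI (\<lambda>\<theta>. \<theta> \<in> Adm) \<theta> \<longleftrightarrow> is_arg_max (\<lambda>\<theta>. ?v \<bullet> \<theta>) (\<lambda>\<theta>. \<theta> \<in> Adm) \<theta>" for \<theta>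
    by (rule is_arg_max_pos_affine_iff[OF cPI H2(2)])
  \<comment> \<open>Closed balls in finite dimension are compact, so the linear form attains its
    maximum and the equivalence of maximisers is not vacuous.\<close>
  have "Adm = cball 0 1"
    by (auto simp: S2)
  then have "\<exists>\<theta>. is_arg_max (\<lambda>\<theta>. ?v \<bullet> \<theta>) (\<lambda>\<theta>. \<theta> \<in> Adm) \<theta>"
    by (intro ex_is_arg_max_compact) (auto intro!: continuous_intros)
  then show ?thesis
    by (simp add: Q_iff cPI_iff)
qed

end
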